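(* Let $\widetilde H=(\widetilde V,\widetilde E)$ be a strongly connected $(2+l)$-uniform hypergraph with $l\ge 1$. Suppose there is a non-empty subset of nodes $V^\star=\{\star_1,\dots,\star_s\}\subset\widetilde V$ such that, for each $k$, the node $\star_k$ is contained exactly $p_k\ge1$ times in every hyperedge of $\widetilde H$, with $\sum_{k=1}^s p_k=l$. Let $V=\widetilde V\setminus V^\star$ and let $H=(V,E)$ be the $2$-uniform hypergraph obtained from $\widetilde H$ by removing the nodes of $V^\star$ (with all their copies) from every hyperedge. Then: (i) For every $\mathcal Z$-eigenvector $\widetilde{\mathbf c}$ of $\widetilde H$, the components $(\widetilde c_i)_{i\in V}$ form, up to scaling, a $\mathcal Z$-eigenvector of $H$, i.e. an eigenvector of the adjacency matrix of $H$. (ii) The components of a positive $\mathcal Z$-eigenvector of $\widetilde H$ associated with the nodes in $V^\star$ are uniquely determined by its components associated with the nodes in $V$. (iii) The $\mathcal Z$-eigenvalues $\widetilde\lambda$ of $\widetilde H$ correspond to the eigenvalues $\lambda$ of $H$, rescaled: if $\widetilde\lambda$ is the $\mathcal Z$-eigenvalue of $\widetilde{\mathbf c}$ and $\lambda$ is the eigenvalue of the adjacency matrix of $H$ associated with $(\widetilde c_i)_{i\in V}$, then $$\widetilde\lambda=\lambda\,\Omega\,(\widetilde c_{\star_1})^{p_1}\cdots(\widetilde c_{\star_s})^{p_s},\qquad \Omega=\frac{(l+1)!}{\prod_{k=1}^s p_k!}.$$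
   Context: A hypergraph $(V,E)$ has a finite node set $V$ and a finite set $E$ of hyperedges, each a multiset of nodes (the same node may occur several times); it is $m$-uniform if every hyperedge has exactly $m$ elements counted with multiplicity. Hyperedges carry positive weights $w(e)$ (equal to $1$ in the unweighted case). The adjacency tensor of an $m$-uniform hypergraph is the symmetric order-$m$ tensor $T$ indexed by nodes with $T_{i_1\dots i_m}=w(\{i_1,\dots,i_m\})$ if the multiset $\{i_1,\dots,i_m\}$ is a hyperedge, and $0$ otherwise; for $m=2$ it is the adjacency matrix. Each hyperedge of $H$ obtained by removing the nodes of $V^\star$ inherits the weight of the hyperedge of $\widetilde H$ it comes from. An order-$m$ tensor $T$ is weakly irreducible if the matrix with entries $m_{ij}=\sum_{j_3,\dots,j_m}|T_{ijj_3\dots j_m}|$ is irreducible; a uniform hypergraph is strongly connected if its adjacency tensor is weakly irreducible (equivalently, the graph joining two nodes whenever some hyperedge contains both is connected). For a vector $\mathbf c$, $(T\mathbf c^{m-1})_{i_1}=\sum_{i_2,\dots,i_m}T_{i_1i_2\dots i_m}c_{i_2}\cdots c_{i_m}$. A $\mathcal Z$-eigenpair of an $m$-uniform hypergraph with adjacency tensor $T$ is a pair $(\lambda,\mathbf c)$ with $\lambda$ real and $\mathbf c$ a real vector satisfying $T\mathbf c^{m-1}=\lambda\mathbf c$ and normalized by $\mathbf c^T\mathbf c=1$; it is positive if all components of $\mathbf c$ are positive. For the $2$-uniform hypergraph $H$, eigenvectors are considered up to scaling, so that a $\mathcal Z$-eigenvector of $H$ is, up to scaling, an eigenvector of its adjacency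 matrix.
   Formalization: Part (i) is false for some eigenvectors with eigenvalue 0 (e.g. the unit vector at a star node); it is stated for Z-eigenvectors with nonzero eigenvalue, or with all star components nonzero and a nonzero restriction to V. *)

theory Defs
  imports Complex_Main "HOL-Library.Multiset"
begin

record 'a hypergraph =
  nodes :: "'a set"
  hyperedges :: "'a multiset set"
  weight :: "'a multiset \<Rightarrow> real"

definition wf_hypergraph :: "'a hypergraph \<Rightarrow> bool" where
  "wf_hypergraph H \<longleftrightarrow>
     finite (nodes H) \<and> finite (hyperedges H) \<and>
     (\<forall>e \<in> hyperedges H. set_mset e \<subseteq> nodes H \<and> weight H e > 0)"

definition uniform :: "nat \<Rightarrow> 'a hypergraph \<Rightarrow> bool" where
  "uniform m H \<longleftrightarrow> (\<forall>e \<in> hyperedges H. size e = m)"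

text \<open>
  Vectors, matrices and tensors indexed by a finite set \<open>V\<close> are functions whose values
  outside \<open>V\<close> are irrelevant: all notions below only look at indices in \<open>V\<close>. In particular,
  the restriction of a vector \<open>c\<close> to a smaller index set is written \<open>c\<close> as well.
  An order-\<open>m\<close> tensor is a function on index lists, used for lists of length \<open>m\<close>.
\<close>

definition index_lists :: "'a set \<Rightarrow> nat \<Rightarrow> 'a list set" where
  "index_lists V n = {js. set js \<subseteq> V \<and> length js = n}"

definition tensor_apply ::
  "'a set \<Rightarrow> nat \<Rightarrow> ('a list \<Rightarrow> real) \<Rightarrow> ('a \<Rightarrow> real) \<Rightarrow> 'a \<Rightarrow> real" where
  "tensor_apply V m T c i = (\<Sum>js \<in> index_lists V (m - 1). T (i # js) * prod_list (map c js))"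

definition irreducible_matrix :: "'a set \<Rightarrow> ('a \<Rightarrow> 'a \<Rightarrow> real) \<Rightarrow> bool" where
  "irreducible_matrix V M \<longleftrightarrow>
     \<not> (\<exists>I. I \<noteq> {} \<and> I \<subset> V \<and> (\<forall>i \<in> I. \<forall>j \<in> V - I. M i j = 0))"

definition weakly_irreducible :: "'a set \<Rightarrow> nat \<Rightarrow> ('a list \<Rightarrow> real) \<Rightarrow> bool" where
  "weakly_irreducible V m T \<longleftrightarrow>
     irreducible_matrix V (\<lambda>i j. \<Sum>js \<in> index_lists V (m - 2). \<bar>T (i # j # js)\<bar>)"

definition matrix_eigenpair ::
  "'a set \<Rightarrow> ('a \<Rightarrow> 'a \<Rightarrow> real) \<Rightarrow> real \<Rightarrow> ('a \<Rightarrow> real) \<Rightarrow> bool" where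
  "matrix_eigenpair V A \<mu> c \<longleftrightarrow>
     (\<exists>i \<in> V. c i \<noteq> 0) \<and> (\<forall>i \<in> V. (\<Sum>j \<in> V. A i j * c j) = \<mu> * c i)"

definition adjacency_tensor :: "'a hypergraph \<Rightarrow> 'a list \<Rightarrow> real" where
  "adjacency_tensor H js = (if mset js \<in> hyperedges H then weight H (mset js) else 0)"

definition adjacency_matrix :: "'a hypergraph \<Rightarrow> 'a \<Rightarrow> 'a \<Rightarrow> real" where
  "adjacency_matrix H i j = adjacency_tensor H [i, j]"

text \<open>
  The uniformity \<open>m\<close> is an explicit argument because a hypergraph without hyperedges is
  \<open>m\<close>-uniform for every \<open>m\<close>.
\<close>

definition strongly_connected :: "nat \<Rightarrow> 'a hypergraph \<Rightarrow> bool" where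
  "strongly_connected m H \<longleftrightarrow> weakly_irreducible (nodes H) m (adjacency_tensor H)"

definition Z_eigenpair :: "nat \<Rightarrow> 'a hypergraph \<Rightarrow> real \<Rightarrow> ('a \<Rightarrow> real) \<Rightarrow> bool" where
  "Z_eigenpair m H \<mu> c \<longleftrightarrow>
     (\<forall>i \<in> nodes H. tensor_apply (nodes H) m (adjacency_tensor H) c i = \<mu> * c i) \<and>
     (\<Sum>i \<in> nodes H. c i * c i) = 1"

definition positive_Z_eigenvector :: "nat \<Rightarrow> 'a hypergraph \<Rightarrow> ('a \<Rightarrow> real) \<Rightarrow> bool" where
  "positive_Z_eigenvector m H c \<longleftrightarrow>
     (\<exists>\<mu>. Z_eigenpair m H \<mu> c) \<and> (\<forall>i \<in> nodes H. c i > 0)"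

definition remove_from_edge :: "'a set \<Rightarrow> 'a multiset \<Rightarrow> 'a multiset" where
  "remove_from_edge S e = filter_mset (\<lambda>v. v \<notin> S) e"

text \<open>
  The weight of a hyperedge is inherited from the hyperedge it comes from. The latter is unique
  when removal is injective on hyperedges, for instance when every node of \<open>S\<close> occurs
  equally often in all hyperedges.
\<close>

definition remove_nodes :: "'a set \<Rightarrow> 'a hypergraph \<Rightarrow> 'a hypergraph" where
  "remove_nodes S H =
     \<lparr>nodes = nodes H - S,
      hyperedges = remove_from_edge S ` hyperedges H,
      weight = (\<lambda>f. weight H (inv_into (hyperedges H) (remove_from_edge S) f))\<rparr>"

end

(* Write a hyperedge of Ht as M + {i, j}, where M consists of p v copies of each v in S.
   At a node i outside S, the orderings of M + {j} contribute the same factor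
   Omega = (l + 1)! / prod (p v)! for every j, so T c^(l+1) at i is Omega * prod (c v)^(p v)
   times (A c) at i, with A the adjacency matrix of H; this gives (i) and (iii).

   With F the value of the form T c^(l+2), an Euler-type count of orderings shows that c_v (T c^(l+1))_v
   weights the contribution of each hyperedge e to F by (count e v) / (l + 2). Hence the eigenvalue of a
   normalized c is F, and if it is nonzero then (c v)^2 = p v / (l + 2) for v in S. This yields (ii), and
   it shows for (i) that c cannot vanish outside S. If there are no hyperedges at all, strong connectivity
   leaves a single node. *)

theory Submission
  imports Defs "HOL-Combinatorics.Multiset_Permutations"
begin

section \<open>Tensor contraction as a sum over hyperedges\<close>

lemma finite_index_lists:
  assumes "finite V"
  shows "finite (index_lists V n)"
  using finite_lists_length_eq[OF assms, of n] by (simp add: index_lists_def)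

text \<open>The tensor entry and the product of components depend only on the multiset of indices,
  so the index lists can be grouped by the hyperedge e = \<open>mset (i # js)\<close>. The group of
  e consists of the orderings of \<open>e - {#i#}\<close>, and the summand is constant on
  it.\<close>

lemma tensor_apply_adjacency_tensor:
  assumes "wf_hypergraph H" and "uniform m H" and "m \<ge> 1"
  shows "tensor_apply (nodes H) m (adjacency_tensor H) c i =
    (\<Sum>e | e \<in> hyperedges H \<and> i \<in># e.
       weight H e * card (permutations_of_multiset (e - {#i#})) * (\<Prod>x\<in>#e - {#i#}. c x))"
proof -
  let ?J = "index_lists (nodes H) (m - 1)"
  let ?E = "{e. e \<in> hyperedges H \<and> i \<in># e}"
  let ?g = "\<lambda>js. weight H (mset (i # js)) * prod_list (map c js)"
  have fin: "finite (nodes H)" "finite ?E"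
    using assms by (auto simp: wf_hypergraph_def)
  have J: "{js \<in> ?J. mset (i # js) \<in> hyperedges H} =
    (\<Union>e\<in>?E. permutations_of_multiset (e - {#i#}))"
  proof (intro equalityI subsetI)
    fix js assume "js \<in> {js \<in> ?J. mset (i # js) \<in> hyperedges H}"
    then show "js \<in> (\<Union>e\<in>?E. permutations_of_multiset (e - {#i#}))"
      by (intro UN_I[of "mset (i # js)"]) (auto simp: permutations_of_multiset_def)
  next
    fix js assume "js \<in> (\<Union>e\<in>?E. permutations_of_multiset (e - {#i#}))"
    then obtain e where e: "e \<in> hyperedges H" "i \<in># e" "mset js = e - {#i#}"
      by (auto simp: permutations_of_multiset_def)
    then have eq: "mset (i # js) = e" by simp
    have "set_mset e \<subseteq> nodes H" "size e = m"
      using e assms by (auto simp: wf_hypergraph_def uniform_def)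
    with eq have "set js \<subseteq> nodes H" "length js = m - 1" by auto
    with e eq show "js \<in> {js \<in> ?J. mset (i # js) \<in> hyperedges H}"
      by (simp add: index_lists_def)
  qed
  have "tensor_apply (nodes H) m (adjacency_tensor H) c i =
    (\<Sum>js\<in>?J. if mset (i # js) \<in> hyperedges H then ?g js else 0)"
    unfolding tensor_apply_def adjacency_tensor_def by (intro sum.cong) auto
  also have "\<dots> = (\<Sum>js | js \<in> ?J \<and> mset (i # js) \<in> hyperedges H. ?g js)"
    using finite_index_lists[OF fin(1)] by (rule sum.inter_filter[symmetric])
  also have "\<dots> = (\<Sum>e\<in>?E. \<Sum>js\<in>permutations_of_multiset (e - {#i#}). ?g js)"
    unfolding J
  proof (rule sum.UNION_disjoint[OF fin(2)], goal_cases)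
    \<comment> \<open>Disjointness: since \<open>i\<close> is fixed, \<open>js\<close> determines
      its hyperedge as \<open>mset (i # js)\<close>.\<close>
    case 2
    show ?case
    proof (intro ballI impI equals0I)
      fix e e' js
      assume "e \<in> ?E" "e' \<in> ?E" "e \<noteq> e'"
        and "js \<in> permutations_of_multiset (e - {#i#}) \<inter> permutations_of_multiset (e' - {#i#})"
      then show False
        by (metis (no_types, lifting) IntE insert_DiffM mem_Collect_eq permutations_of_multisetD)
    qed
  qed auto
  also have "\<dots> = (\<Sum>e\<in>?E. \<Sum>js\<in>permutations_of_multiset (e - {#i#}).
      weight H e * (\<Prod>x\<in>#e - {#i#}. c x))"
  proof (intro sum.cong refl)
    fix e js assume "e \<in> ?E" "js \<in> permutations_of_multiset (e - {#i#})"
    then have "mset (i # js) = e" "mset (map c js) = image_mset c (e - {#i#})"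
      by (auto simp: permutations_of_multiset_def)
    then show "?g js = weight H e * (\<Prod>x\<in>#e - {#i#}. c x)"
      by (metis prod_mset_prod_list)
  qed
  finally show ?thesis
    by (simp add: mult_ac)
qed

section \<open>The homogeneous form of the adjacency tensor and its eigenvalues\<close>

text \<open>The full contraction T c^m of an m-uniform hypergraph, with the index lists already
  grouped by hyperedge; its gradient is m times T c^(m-1).\<close>

definition adjacency_form :: "'a hypergraph \<Rightarrow> ('a \<Rightarrow> real) \<Rightarrow> real" where
  "adjacency_form H c =
     (\<Sum>e\<in>hyperedges H. weight H e * card (permutations_of_multiset e) * (\<Prod>x\<in>#e. c x))"

text \<open>Among all orderings of a hyperedge e, the fraction that starts with \<open>i\<close> is
  \<open>count e i / m\<close>, and the factor \<open>c i\<close> completes the product over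
  \<open>e - {#i#}\<close> to the product over e.\<close>

lemma mult_tensor_apply_adjacency_tensor:
  assumes "wf_hypergraph H" and "uniform m H" and "m \<ge> 1"
  shows "c i * tensor_apply (nodes H) m (adjacency_tensor H) c i =
    (\<Sum>e\<in>hyperedges H.
       weight H e * card (permutations_of_multiset e) * (\<Prod>x\<in>#e. c x) * (count e i / m))"
proof -
  let ?h = "\<lambda>e. weight H e * card (permutations_of_multiset e) * (\<Prod>x\<in>#e. c x) * (count e i / m)"
  have fin: "finite (hyperedges H)"
    using assms by (auto simp: wf_hypergraph_def)
  have "c i * tensor_apply (nodes H) m (adjacency_tensor H) c i =
    (\<Sum>e | e \<in> hyperedges H \<and> i \<in># e. ?h e)"
    unfolding tensor_apply_adjacency_tensor[OF assms] sum_distrib_left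
  proof (intro sum.cong refl)
    fix e assume "e \<in> {e. e \<in> hyperedges H \<and> i \<in># e}"
    then have e: "e \<in> hyperedges H" "i \<in># e" by auto
    have "size e = m" using e assms by (auto simp: uniform_def)
    have "(\<Prod>x\<in>#e. c x) = c i * (\<Prod>x\<in>#e - {#i#}. c x)"
      using e by (metis image_mset_add_mset insert_DiffM prod_mset.add_mset)
    moreover have "real (card (permutations_of_multiset (e - {#i#}))) =
        card (permutations_of_multiset e) * count e i / m"
      using arg_cong[OF card_permutations_of_multiset_remove_aux[OF e(2)], of real]
        \<open>size e = m\<close> \<open>m \<ge> 1\<close>
      by (simp add: field_simps)
    ultimately show "c i * (weight H e * card (permutations_of_multiset (e - {#i#})) *
        (\<Prod>x\<in>#e - {#i#}. c x)) = ?h e"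
      by simp
  qed
  \<comment> \<open>Hyperedges that avoid \<open>i\<close> have count 0 and may be added
    freely.\<close>
  also have "\<dots> = (\<Sum>e\<in>hyperedges H. ?h e)"
    using fin by (intro sum.mono_neutral_left) (auto simp: count_eq_zero_iff)
  finally show ?thesis .
qed

text \<open>Pair the eigenvalue equation with \<open>c\<close>: the normalization leaves
  \<open>\<mu>\<close> on one side, and on the other the fractions \<open>count e i / m\<close> of
  each hyperedge add up to 1.\<close>

lemma Z_eigenvalue_eq_adjacency_form:
  assumes "wf_hypergraph H" and "uniform m H" and "m \<ge> 1" and "Z_eigenpair m H \<mu> c"
  shows "\<mu> = adjacency_form H c"
proof -
  let ?h = "\<lambda>e. weight H e * card (permutations_of_multiset e) * (\<Prod>x\<in>#e. c x)"
  have "\<mu> = (\<Sum>i\<in>nodes H. \<mu> * (c i * c i))"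
    using assms(4) by (simp add: Z_eigenpair_def flip: sum_distrib_left)
  also have "\<dots> = (\<Sum>i\<in>nodes H. c i * tensor_apply (nodes H) m (adjacency_tensor H) c i)"
    using assms(4) by (intro sum.cong) (auto simp: Z_eigenpair_def)
  also have "\<dots> = (\<Sum>e\<in>hyperedges H. \<Sum>i\<in>nodes H. ?h e * (count e i / m))"
    unfolding mult_tensor_apply_adjacency_tensor[OF assms(1-3)] by (rule sum.swap)
  also have "\<dots> = (\<Sum>e\<in>hyperedges H. ?h e)"
  proof (intro sum.cong refl)
    fix e assume "e \<in> hyperedges H"
    then have "set_mset e \<subseteq> nodes H" "size e = m" "finite (nodes H)"
      using assms by (auto simp: wf_hypergraph_def uniform_def)
    then have "(\<Sum>i\<in>nodes H. count e i) = m"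
      by (metis count_eq_zero_iff size_multiset_overloaded_eq sum.mono_neutral_left DiffD2)
    then have "(\<Sum>i\<in>nodes H. real (count e i)) = real m"
      by (metis of_nat_sum)
    then have "(\<Sum>i\<in>nodes H. count e i / m) = (1::real)"
      using \<open>m \<ge> 1\<close> by (simp flip: sum_divide_distrib)
    then show "(\<Sum>i\<in>nodes H. ?h e * (count e i / m)) = ?h e"
      unfolding sum_distrib_left[symmetric] by simp
  qed
  finally show ?thesis by (simp add: adjacency_form_def)
qed

text \<open>If \<open>count e v\<close> is the same for all hyperedges, the fraction k / m factors
  out of the sum, and what remains is the form, that is, \<open>\<mu>\<close> itself. Cancelling
  \<open>\<mu>\<close> gives the square.\<close>

lemma Z_eigenvector_square_of_constant_count:
  assumes "wf_hypergraph H" and "uniform m H" and "m \<ge> 1" and "Z_eigenpair m H \<mu> c"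
    and "\<mu> \<noteq> 0" and "v \<in> nodes H" and "\<And>e. e \<in> hyperedges H \<Longrightarrow> count e v = k"
  shows "(c v)\<^sup>2 = k / m"
proof -
  have "\<mu> * (c v)\<^sup>2 = c v * tensor_apply (nodes H) m (adjacency_tensor H) c v"
    using assms(4,6) by (simp add: Z_eigenpair_def power2_eq_square)
  also have "\<dots> = adjacency_form H c * (k / m)"
    unfolding mult_tensor_apply_adjacency_tensor[OF assms(1-3)] adjacency_form_def sum_distrib_right
    using assms(7) by (intro sum.cong) auto
  also have "\<dots> = \<mu> * (k / m)"
    using Z_eigenvalue_eq_adjacency_form[OF assms(1-4)] by simp
  finally show ?thesis using \<open>\<mu> \<noteq> 0\<close> by (metis mult_left_cancel)
qed

lemma adjacency_form_pos:
  assumes "wf_hypergraph H" and "hyperedges H \<noteq> {}" and "\<And>i. i \<in> nodes H \<Longrightarrow> c i > 0"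
  shows "adjacency_form H c > 0"
  unfolding adjacency_form_def
proof (rule sum_pos)
  fix e assume e: "e \<in> hyperedges H"
  then have "set_mset e \<subseteq> nodes H" "weight H e > 0"
    using assms(1) by (auto simp: wf_hypergraph_def)
  moreover from this(1) have "(\<Prod>x\<in>#e. c x) > 0"
    by (induction e) (auto intro!: mult_pos_pos assms(3))
  moreover have "card (permutations_of_multiset e) > 0"
    by (simp add: card_gt_0_iff)
  ultimately show "weight H e * card (permutations_of_multiset e) * (\<Prod>x\<in>#e. c x) > 0"
    by simp
qed (use assms in \<open>auto simp: wf_hypergraph_def\<close>)

text \<open>The zero tensor separates {v} from any other nodes. This settles the degenerate case in
  which the form vanishes and \<open>\<mu>\<close> cannot be cancelled.\<close>

lemma strongly_connected_without_hyperedges: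
  assumes "strongly_connected m H" and "hyperedges H = {}" and "v \<in> nodes H"
  shows "nodes H = {v}"
proof (rule ccontr)
  assume "nodes H \<noteq> {v}"
  with assms(3) have "{v} \<subset> nodes H" by auto
  moreover have "\<forall>i\<in>{v}. \<forall>j\<in>nodes H - {v}.
      (\<Sum>js\<in>index_lists (nodes H) (m - 2). \<bar>adjacency_tensor H (i # j # js)\<bar>) = 0"
    using assms(2) by (simp add: adjacency_tensor_def)
  ultimately show False
    using assms(1)
    unfolding strongly_connected_def weakly_irreducible_def irreducible_matrix_def by blast
qed

section \<open>Order 2: adjacency matrices and scaling of eigenvectors\<close>

lemma adjacency_matrix_mult_eq_tensor_apply:
  assumes "finite (nodes H)"
  shows "(\<Sum>j\<in>nodes H. adjacency_matrix H i j * c j) =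
    tensor_apply (nodes H) 2 (adjacency_tensor H) c i"
proof -
  have "index_lists (nodes H) 1 = (\<lambda>j. [j]) ` nodes H"
    by (auto simp: index_lists_def length_Suc_conv)
  then show ?thesis
    by (simp add: tensor_apply_def adjacency_matrix_def sum.reindex inj_on_def)
qed

lemma matrix_eigenpair_imp_Z_eigenpair:
  assumes "finite (nodes H)" and "matrix_eigenpair (nodes H) (adjacency_matrix H) \<nu> c"
  shows "\<exists>\<alpha>. \<alpha> \<noteq> 0 \<and> Z_eigenpair 2 H \<nu> (\<lambda>i. \<alpha> * c i)"
proof -
  let ?s = "\<Sum>i\<in>nodes H. c i * c i"
  \<comment> \<open>The matrix equation is linear in \<open>c\<close>, so dividing by the Euclidean
    norm keeps the eigenvalue and supplies the normalization.\<close>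
  let ?\<alpha> = "1 / sqrt ?s"
  obtain i where "i \<in> nodes H" "c i \<noteq> 0"
    using assms(2) by (auto simp: matrix_eigenpair_def)
  then have s: "?s > 0"
    using assms(1) by (intro sum_pos2[of _ i]) (auto simp: zero_less_mult_iff)
  have "(\<Sum>i\<in>nodes H. ?\<alpha> * c i * (?\<alpha> * c i)) = ?\<alpha> * ?\<alpha> * ?s"
    unfolding sum_distrib_left by (intro sum.cong) auto
  also have "\<dots> = 1"
    using s by simp
  finally have norm: "(\<Sum>i\<in>nodes H. ?\<alpha> * c i * (?\<alpha> * c i)) = 1" .
  have "tensor_apply (nodes H) 2 (adjacency_tensor H) (\<lambda>i. ?\<alpha> * c i) i = \<nu> * (?\<alpha> * c i)"
    if "i \<in> nodes H" for i
  proof -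
    have "tensor_apply (nodes H) 2 (adjacency_tensor H) (\<lambda>i. ?\<alpha> * c i) i =
      (\<Sum>j\<in>nodes H. ?\<alpha> * (adjacency_matrix H i j * c j))"
      unfolding adjacency_matrix_mult_eq_tensor_apply[OF assms(1), symmetric]
      by (intro sum.cong) auto
    also have "\<dots> = ?\<alpha> * (\<nu> * c i)"
      unfolding sum_distrib_left[symmetric] using assms(2) that
      by (simp add: matrix_eigenpair_def)
    finally show ?thesis by simp
  qed
  with norm s show ?thesis
    unfolding Z_eigenpair_def by (intro exI[of _ ?\<alpha>]) auto
qed

section \<open>Hypergraphs whose hyperedges share a common part\<close>

locale common_core =
  fixes Ht :: "'a hypergraph" and S :: "'a set" and p :: "'a \<Rightarrow> nat" and l :: nat
  assumes wf: "wf_hypergraph Ht" and unif: "uniform (2 + l) Ht"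
    and S_nodes: "S \<subseteq> nodes Ht"
    and p_pos: "v \<in> S \<Longrightarrow> p v \<ge> 1"
    and count_S: "e \<in> hyperedges Ht \<Longrightarrow> v \<in> S \<Longrightarrow> count e v = p v"
    and sum_p: "(\<Sum>v\<in>S. p v) = l"
begin

definition core :: "'a multiset" where
  "core = (\<Sum>v\<in>S. replicate_mset (p v) v)"

lemma finite_S: "finite S"
  using S_nodes wf finite_subset by (auto simp: wf_hypergraph_def)

lemma count_core: "count core v = (if v \<in> S then p v else 0)"
  using finite_S by (simp add: core_def count_sum if_distrib cong: if_cong)

lemma set_core: "set_mset core = S"
  using p_pos by (auto simp: count_core Suc_le_eq simp flip: count_greater_zero_iff split: if_splits)

lemma size_core: "size core = l"
  using sum_p by (simp add: size_multiset_overloaded_eq set_core count_core)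

lemma prod_core: "(\<Prod>x\<in>#core. c x) = (\<Prod>v\<in>S. c v ^ p v)" for c :: "'a \<Rightarrow> real"
  unfolding core_def using finite_S by (induction S) auto

lemma hyperedge_decomp:
  assumes "e \<in> hyperedges Ht"
  shows "e = core + remove_from_edge S e"
  using assms by (intro multiset_eqI) (auto simp: remove_from_edge_def count_core count_S)

text \<open>Adding \<open>core\<close> back recovers the hyperedge. Hence \<open>inv_into\<close> in
  \<open>remove_nodes\<close> picks the true origin of each edge, and weights are inherited as
  intended.\<close>

lemma inj_on_remove: "inj_on (remove_from_edge S) (hyperedges Ht)"
proof (rule inj_onI)
  fix e e' assume "e \<in> hyperedges Ht" "e' \<in> hyperedges Ht"
    and eq: "remove_from_edge S e = remove_from_edge S e'"
  then have "e = core + remove_from_edge S e" "e' = core + remove_from_edge S e'"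
    using hyperedge_decomp by blast+
  with eq show "e = e'" by (simp only:)
qed

lemma size_remove:
  assumes "e \<in> hyperedges Ht"
  shows "size (remove_from_edge S e) = 2"
proof -
  have "size e = 2 + l" using assms unif by (auto simp: uniform_def)
  moreover have "size e = l + size (remove_from_edge S e)"
    using hyperedge_decomp[OF assms] size_core by (metis size_union)
  ultimately show ?thesis by simp
qed

lemma weight_remove_nodes:
  assumes "e \<in> hyperedges Ht"
  shows "weight (remove_nodes S Ht) (remove_from_edge S e) = weight Ht e"
  using assms inj_on_remove by (simp add: remove_nodes_def)

lemma wf_remove_nodes: "wf_hypergraph (remove_nodes S Ht)"
proof -
  have "weight (remove_nodes S Ht) (remove_from_edge S e) > 0" if "e \<in> hyperedges Ht" for e
    using weight_remove_nodes[OF that] wf that by (auto simp: wf_hypergraph_def)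
  then show ?thesis
    using wf by (auto simp: wf_hypergraph_def remove_nodes_def remove_from_edge_def)
qed

lemma uniform_remove_nodes: "uniform 2 (remove_nodes S Ht)"
  using size_remove by (auto simp: uniform_def remove_nodes_def)

text \<open>A multinomial coefficient: \<open>j\<close> lies outside \<open>core\<close>, so it
  occurs once and contributes the factor 1! to the denominator. The value is therefore the same for
  all such \<open>j\<close>.\<close>

lemma card_permutations_core:
  assumes "j \<notin> S"
  shows "real (card (permutations_of_multiset (core + {#j#}))) =
    fact (l + 1) / (\<Prod>v\<in>S. fact (p v))"
proof -
  have "(\<Prod>x\<in>set_mset (core + {#j#}). fact (count (core + {#j#}) x)) =
    (\<Prod>v\<in>S. fact (p v) :: nat)"
  proof -
    have "(\<Prod>x\<in>S. fact (count (core + {#j#}) x)) = (\<Prod>v\<in>S. fact (p v) :: nat)"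
      using assms by (intro prod.cong) (auto simp: count_core)
    then show ?thesis
      using finite_S assms by (simp add: set_core count_core)
  qed
  then have "(\<Prod>v\<in>S. fact (p v)) * card (permutations_of_multiset (core + {#j#})) = fact (l + 1)"
    using card_permutations_of_multiset_aux[of "core + {#j#}"] size_core
    by (simp add: mult_ac)
  then have "(\<Prod>v\<in>S. fact (p v)) * real (card (permutations_of_multiset (core + {#j#}))) = fact (l + 1)"
    by (drule_tac arg_cong[where f = real]) (simp only: of_nat_fact of_nat_mult of_nat_prod)
  moreover have "(\<Prod>v\<in>S. fact (p v) :: real) \<noteq> 0"
    using finite_S by simp
  ultimately show ?thesis
    by (simp add: field_simps)
qed

text \<open>Removal matches the hyperedges at \<open>i\<close> in both hypergraphs. Beside
  \<open>i\<close>, a hyperedge of \<open>Ht\<close> leaves \<open>core + {#j#}\<close>, while its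
  image leaves only \<open>{#j#}\<close>, which has a single ordering; the two terms differ by the
  factor \<open>?\<Omega> * ?P\<close>.\<close>

lemma tensor_apply_remove_nodes:
  assumes "i \<in> nodes (remove_nodes S Ht)"
  shows "tensor_apply (nodes Ht) (2 + l) (adjacency_tensor Ht) c i =
    (fact (l + 1) / (\<Prod>v\<in>S. fact (p v))) * (\<Prod>v\<in>S. c v ^ p v) *
    (\<Sum>j\<in>nodes (remove_nodes S Ht). adjacency_matrix (remove_nodes S Ht) i j * c j)"
    (is "_ = ?\<Omega> * ?P * _")
proof -
  let ?H = "remove_nodes S Ht"
  let ?r = "remove_from_edge S"
  have i: "i \<notin> S" using assms by (simp add: remove_nodes_def)
  have E: "{f. f \<in> hyperedges ?H \<and> i \<in># f} = ?r ` {e. e \<in> hyperedges Ht \<and> i \<in># e}"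
    using i by (auto simp: remove_nodes_def remove_from_edge_def)
  have inj: "inj_on ?r {e. e \<in> hyperedges Ht \<and> i \<in># e}"
    using inj_on_remove by (rule inj_on_subset) auto
  have fin: "finite (nodes ?H)" using wf_remove_nodes by (simp add: wf_hypergraph_def)
  have "tensor_apply (nodes Ht) (2 + l) (adjacency_tensor Ht) c i =
    (\<Sum>e | e \<in> hyperedges Ht \<and> i \<in># e.
      weight Ht e * card (permutations_of_multiset (e - {#i#})) * (\<Prod>x\<in>#e - {#i#}. c x))"
    by (rule tensor_apply_adjacency_tensor[OF wf unif]) simp
  also have "\<dots> = (\<Sum>e | e \<in> hyperedges Ht \<and> i \<in># e. ?\<Omega> * ?P *
      (weight ?H (?r e) * card (permutations_of_multiset (?r e - {#i#})) * (\<Prod>x\<in>#?r e - {#i#}. c x)))"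
  proof (intro sum.cong refl)
    fix e assume "e \<in> {e. e \<in> hyperedges Ht \<and> i \<in># e}"
    then have e: "e \<in> hyperedges Ht" "i \<in># e" by auto
    then have ir: "i \<in># ?r e" using i by (simp add: remove_from_edge_def)
    have "size (?r e - {#i#}) = 1"
      using size_remove[OF e(1)] ir by (simp add: size_Diff_singleton)
    \<comment> \<open>Here \<open>j\<close> may equal \<open>i\<close>, when the edge of the smaller
      hypergraph is a loop.\<close>
    then obtain j where j: "?r e - {#i#} = {#j#}"
      using size_1_singleton_mset by blast
    then have "j \<in># ?r e" by (metis in_diffD union_single_eq_member)
    then have jS: "j \<notin> S" by (simp add: remove_from_edge_def)
    have "e - {#i#} = core + {#j#}"
      using hyperedge_decomp[OF e(1)] j ir by (metis multiset_diff_union_assoc single_subset_iff)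
    then have "real (card (permutations_of_multiset (e - {#i#}))) = ?\<Omega>"
      "(\<Prod>x\<in>#e - {#i#}. c x) = ?P * c j"
      using card_permutations_core[OF jS] by (simp_all add: prod_core)
    then show "weight Ht e * card (permutations_of_multiset (e - {#i#})) * (\<Prod>x\<in>#e - {#i#}. c x) =
      ?\<Omega> * ?P *
      (weight ?H (?r e) * card (permutations_of_multiset (?r e - {#i#})) * (\<Prod>x\<in>#?r e - {#i#}. c x))"
      by (simp add: weight_remove_nodes[OF e(1)] j)
  qed
  also have "\<dots> = ?\<Omega> * ?P * tensor_apply (nodes ?H) 2 (adjacency_tensor ?H) c i"
    unfolding tensor_apply_adjacency_tensor[OF wf_remove_nodes uniform_remove_nodes one_le_numeral]
      E sum.reindex[OF inj] sum_distrib_left by simp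
  finally show ?thesis
    by (simp add: adjacency_matrix_mult_eq_tensor_apply[OF fin])
qed

lemma Z_eigenvector_square_core:
  assumes "Z_eigenpair (2 + l) Ht \<mu> c" and "\<mu> \<noteq> 0" and "v \<in> S"
  shows "(c v)\<^sup>2 = p v / (2 + l)"
  using Z_eigenvector_square_of_constant_count[OF wf unif _ assms(1,2)] assms(3) S_nodes count_S
  by auto

text \<open>The components on \<open>S\<close> contribute only l / (2 + l) < 1 to the squared norm,
  so some of it must come from outside \<open>S\<close>.\<close>

lemma Z_eigenvector_nonzero_remove_nodes:
  assumes "Z_eigenpair (2 + l) Ht \<mu> c" and "\<mu> \<noteq> 0"
  shows "\<exists>i\<in>nodes (remove_nodes S Ht). c i \<noteq> 0"
proof (rule ccontr)
  assume "\<not> ?thesis"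
  then have zero: "\<And>i. i \<in> nodes Ht - S \<Longrightarrow> c i = 0"
    by (auto simp: remove_nodes_def)
  have "1 = (\<Sum>i\<in>nodes Ht. c i * c i)"
    using assms(1) by (simp add: Z_eigenpair_def)
  also have "\<dots> = (\<Sum>v\<in>S. c v * c v)"
    using S_nodes wf zero by (intro sum.mono_neutral_right) (auto simp: wf_hypergraph_def)
  also have "\<dots> = (\<Sum>v\<in>S. p v / (2 + l))"
    using Z_eigenvector_square_core[OF assms] by (intro sum.cong) (auto simp: power2_eq_square)
  also have "\<dots> = l / (2 + l)"
    using sum_p by (simp flip: sum_divide_distrib of_nat_sum)
  finally show False by simp
qed

end

text \<open>The first part asks for a nonzero eigenvalue or nonvanishing components because of
  degenerate eigenvectors: for the single hyperedge {s, 1, 2} of weight 1 with S = {s} and l = 1,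
  the unit vector at node 1 has eigenvalue 0, but its restriction is no eigenvector of the edge
  joining 1 and 2.\<close>

theorem theorem5p2:
  fixes Ht H :: "'a hypergraph" and S :: "'a set" and p :: "'a \<Rightarrow> nat" and l :: nat
  assumes "wf_hypergraph Ht" and "uniform (2 + l) Ht" and "strongly_connected (2 + l) Ht"
    and "l \<ge> 1"
    and "S \<noteq> {}" and "S \<subseteq> nodes Ht"
    and "\<forall>v \<in> S. p v \<ge> 1"
    and "\<forall>e \<in> hyperedges Ht. \<forall>v \<in> S. count e v = p v"
    and "(\<Sum>v \<in> S. p v) = l"
    and "H = remove_nodes S Ht"
  shows
    "(\<forall>\<mu> c. Z_eigenpair (2 + l) Ht \<mu> c \<and>
        (\<mu> \<noteq> 0 \<or> ((\<forall>v \<in> S. c v \<noteq> 0) \<and> (\<exists>i \<in> nodes H. c i \<noteq> 0))) \<longrightarrow>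
        (\<exists>\<nu>. matrix_eigenpair (nodes H) (adjacency_matrix H) \<nu> c \<and>
             (\<exists>\<alpha>. \<alpha> \<noteq> 0 \<and> Z_eigenpair 2 H \<nu> (\<lambda>i. \<alpha> * c i)))) \<and>
     (\<forall>c d. positive_Z_eigenvector (2 + l) Ht c \<and> positive_Z_eigenvector (2 + l) Ht d \<and>
        (\<forall>i \<in> nodes H. c i = d i) \<longrightarrow> (\<forall>v \<in> S. c v = d v)) \<and>
     (\<forall>\<mu> c \<nu>. Z_eigenpair (2 + l) Ht \<mu> c \<and>
        matrix_eigenpair (nodes H) (adjacency_matrix H) \<nu> c \<longrightarrow>
        \<mu> = \<nu> * (fact (l + 1) / (\<Prod>v \<in> S. fact (p v))) * (\<Prod>v \<in> S. c v ^ p v))"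
proof -
  interpret common_core Ht S p l
    using assms by unfold_locales auto
  define \<Omega> :: real where "\<Omega> = fact (l + 1) / (\<Prod>v \<in> S. fact (p v))"
  define P where "P c = (\<Prod>v \<in> S. c v ^ p v)" for c :: "'a \<Rightarrow> real"
  have "\<Omega> \<noteq> 0"
    using finite_S by (simp add: \<Omega>_def)
  have finH: "finite (nodes H)"
    using wf_remove_nodes assms(10) by (simp add: wf_hypergraph_def)
  have eigen: "\<mu> * c i = \<Omega> * P c * (\<Sum>j\<in>nodes H. adjacency_matrix H i j * c j)"
    if "Z_eigenpair (2 + l) Ht \<mu> c" "i \<in> nodes H" for \<mu> c i
  proof -
    have "\<mu> * c i = tensor_apply (nodes Ht) (2 + l) (adjacency_tensor Ht) c i"
      using that assms(10) by (simp add: Z_eigenpair_def remove_nodes_def)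
    with tensor_apply_remove_nodes[of i c] that(2) assms(10) show ?thesis
      by (simp add: \<Omega>_def P_def)
  qed
  have "\<exists>\<nu>. matrix_eigenpair (nodes H) (adjacency_matrix H) \<nu> c \<and>
      (\<exists>\<alpha>. \<alpha> \<noteq> 0 \<and> Z_eigenpair 2 H \<nu> (\<lambda>i. \<alpha> * c i))"
    if Z: "Z_eigenpair (2 + l) Ht \<mu> c"
      and nz: "\<mu> \<noteq> 0 \<or> ((\<forall>v \<in> S. c v \<noteq> 0) \<and> (\<exists>i \<in> nodes H. c i \<noteq> 0))" for \<mu> c
  proof -
    have ex: "\<exists>i \<in> nodes H. c i \<noteq> 0"
      using nz Z_eigenvector_nonzero_remove_nodes[OF Z] assms(10) by auto
    \<comment> \<open>For nonzero \<open>\<mu>\<close>, evaluate \<open>eigen\<close> at a node with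
      \<open>c i \<noteq> 0\<close>: its left side is nonzero, hence so is the factor
      \<open>P c\<close>.\<close>
    have "P c \<noteq> 0"
    proof (cases "\<mu> = 0")
      case True
      with nz show ?thesis using finite_S by (auto simp: P_def)
    next
      case False
      with ex eigen[OF Z] show ?thesis by fastforce
    qed
    then have "matrix_eigenpair (nodes H) (adjacency_matrix H) (\<mu> / (\<Omega> * P c)) c"
      using ex eigen[OF Z] \<open>\<Omega> \<noteq> 0\<close> by (auto simp: matrix_eigenpair_def field_simps)
    with matrix_eigenpair_imp_Z_eigenpair[OF finH] show ?thesis by blast
  qed
  moreover have "c v = d v"
    if c: "positive_Z_eigenvector (2 + l) Ht c" and d: "positive_Z_eigenvector (2 + l) Ht d"
      and v: "v \<in> S" for c d v
  proof -
    \<comment> \<open>A positive component is determined by its square. Without hyperedges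
      \<open>v\<close> is the only node, and the normalization makes the square 1.\<close>
    have square: "(x v)\<^sup>2 = (if hyperedges Ht = {} then 1 else p v / (2 + l))"
      if x: "positive_Z_eigenvector (2 + l) Ht x" for x
    proof -
      obtain \<mu> where Z: "Z_eigenpair (2 + l) Ht \<mu> x" and pos: "\<And>i. i \<in> nodes Ht \<Longrightarrow> x i > 0"
        using x by (auto simp only: positive_Z_eigenvector_def)
      show ?thesis
      proof (cases "hyperedges Ht = {}")
        case True
        with strongly_connected_without_hyperedges[OF assms(3)] v S_nodes
        have "nodes Ht = {v}" by auto
        with Z True show ?thesis by (simp add: Z_eigenpair_def power2_eq_square)
      next
        case False
        \<comment> \<open>The eigenvalue equals the form, a nonempty sum of positive terms.\<close>
        then have "\<mu> > 0"
          using adjacency_form_pos[OF wf _ pos] Z_eigenvalue_eq_adjacency_form[OF wf unif _ Z] by simp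
        with Z_eigenvector_square_core[OF Z _ v] False show ?thesis by simp
      qed
    qed
    moreover have "c v > 0" "d v > 0"
      using c d v S_nodes by (auto simp: positive_Z_eigenvector_def)
    ultimately show ?thesis
      using c d by (metis less_imp_le power2_eq_imp_eq)
  qed
  moreover have "\<mu> = \<nu> * \<Omega> * P c"
    if Z: "Z_eigenpair (2 + l) Ht \<mu> c"
      and M: "matrix_eigenpair (nodes H) (adjacency_matrix H) \<nu> c" for \<mu> c \<nu>
  proof -
    \<comment> \<open>At such a node both eigenvalue equations express the same quantity, and
      \<open>c i\<close> cancels.\<close>
    obtain i where i: "i \<in> nodes H" "c i \<noteq> 0"
      using M by (auto simp: matrix_eigenpair_def)
    then have "(\<Sum>j\<in>nodes H. adjacency_matrix H i j * c j) = \<nu> * c i"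
      using M by (simp add: matrix_eigenpair_def)
    with eigen[OF Z i(1)] have "\<mu> * c i = \<Omega> * P c * (\<nu> * c i)"
      by simp
    with i show ?thesis by simp
  qed
  ultimately show ?thesis
    unfolding \<Omega>_def P_def by blast
qed

end
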